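(* Let $n\geq 2$ be an integer with $n\neq 3$ and let $S$ be a sequence in $\mathbb Z_n$. Then $S$ is an $E$-extremal sequence for $(\mathbb Z_n',\{1\})$ if and only if $S$ is a translate of an $E$-extremal sequence for $\mathbb Z_n'$.
   Context: $\mathbb Z_n=\mathbb Z/n\mathbb Z$ as a module over itself and $\mathbb Z_n'=\mathbb Z_n\setminus\{0\}$. A subsequence is a non-empty subfamily of terms in the original order. For non-empty $A,B\subseteq\mathbb Z_n$, a sequence $(x_1,\ldots,x_k)$ is an $A$-weighted zero-sum sequence if there exist $a_i\in A$ with $\sum a_ix_i=0$, and an $(A,B)$-weighted zero-sum sequence if moreover there exist $b_i\in B$ with $\sum b_ia_i=0$ (for the same $a_i$). $E_{A,B}(n)$ (resp. $E_A(n)$) is the least positive $k$ such that every sequence of length $k$ in $\mathbb Z_n$ has an $(A,B)$-weighted (resp. $A$-weighted) zero-sum subsequence of length $n$. An $E$-extremal sequence for $(A,B)$ (resp. for $A$) is a sequence of length $E_{A,B}(n)-1$ (resp. $E_A(n)-1$) having no $(A,B)$-weighted (resp. $A$-weighted) zero-sum subsequence of length $n$. A translate of $(x_1,\ldots,x_k)$ is $(x_1+x,\ldots,x_k+x)$ for some $x\in\mathbb Z_n$. *)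

theory Defs
  imports Complex_Main "HOL-Number_Theory.Cong" "HOL-Library.Sublist"
begin

text \<open>
  The ring of integers modulo \<open>n\<close> is represented by the canonical representatives
  \<open>0, \<dots>, n - 1\<close>, as in the library's \<open>residue_ring\<close>; equations in it
  are congruences modulo \<open>n\<close>. Sequences are lists.
\<close>

definition Zn :: "nat \<Rightarrow> int set" where
  "Zn n = {0..<int n}"

definition Zn' :: "nat \<Rightarrow> int set" where
  "Zn' n = Zn n - {0}"

definition seq_in :: "nat \<Rightarrow> int list \<Rightarrow> bool" where
  "seq_in n xs \<longleftrightarrow> set xs \<subseteq> Zn n"

definition subsequence :: "int list \<Rightarrow> int list \<Rightarrow> bool" where
  "subsequence T S \<longleftrightarrow> T \<noteq> [] \<and> subseq T S"

definition weighted_zero_sum :: "nat \<Rightarrow> int set \<Rightarrow> int list \<Rightarrow> bool" where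
  "weighted_zero_sum n A xs \<longleftrightarrow>
     (\<exists>as. length as = length xs \<and> set as \<subseteq> A \<and>
           [(\<Sum>i<length xs. as ! i * xs ! i) = 0] (mod int n))"

definition weighted_zero_sum2 :: "nat \<Rightarrow> int set \<Rightarrow> int set \<Rightarrow> int list \<Rightarrow> bool" where
  "weighted_zero_sum2 n A B xs \<longleftrightarrow>
     (\<exists>as bs. length as = length xs \<and> set as \<subseteq> A \<and>
              length bs = length xs \<and> set bs \<subseteq> B \<and>
              [(\<Sum>i<length xs. as ! i * xs ! i) = 0] (mod int n) \<and>
              [(\<Sum>i<length xs. bs ! i * as ! i) = 0] (mod int n))"

definition has_wzs_subseq :: "nat \<Rightarrow> int set \<Rightarrow> int list \<Rightarrow> bool" where
  "has_wzs_subseq n A S \<longleftrightarrow>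
     (\<exists>T. subsequence T S \<and> length T = n \<and> weighted_zero_sum n A T)"

definition has_wzs2_subseq :: "nat \<Rightarrow> int set \<Rightarrow> int set \<Rightarrow> int list \<Rightarrow> bool" where
  "has_wzs2_subseq n A B S \<longleftrightarrow>
     (\<exists>T. subsequence T S \<and> length T = n \<and> weighted_zero_sum2 n A B T)"

definition E_const :: "nat \<Rightarrow> int set \<Rightarrow> nat" where
  "E_const n A =
     (LEAST k. k > 0 \<and> (\<forall>S. seq_in n S \<and> length S = k \<longrightarrow> has_wzs_subseq n A S))"

definition E_const2 :: "nat \<Rightarrow> int set \<Rightarrow> int set \<Rightarrow> nat" where
  "E_const2 n A B =
     (LEAST k. k > 0 \<and> (\<forall>S. seq_in n S \<and> length S = k \<longrightarrow> has_wzs2_subseq n A B S))"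

definition E_extremal :: "nat \<Rightarrow> int set \<Rightarrow> int list \<Rightarrow> bool" where
  "E_extremal n A S \<longleftrightarrow>
     seq_in n S \<and> length S = E_const n A - 1 \<and> \<not> has_wzs_subseq n A S"

definition E_extremal2 :: "nat \<Rightarrow> int set \<Rightarrow> int set \<Rightarrow> int list \<Rightarrow> bool" where
  "E_extremal2 n A B S \<longleftrightarrow>
     seq_in n S \<and> length S = E_const2 n A B - 1 \<and> \<not> has_wzs2_subseq n A B S"

definition is_translate :: "nat \<Rightarrow> int list \<Rightarrow> int list \<Rightarrow> bool" where
  "is_translate n S T \<longleftrightarrow> (\<exists>x\<in>Zn n. S = map (\<lambda>y. (y + x) mod int n) T)"

end

theory Submission
  imports Defs "HOL-Library.Multiset"
begin

text \<open>
  Group equal terms of a sequence of length \<open>n\<close>. For \<open>n \<ge> 3\<close>, non-zero weights on a group of at least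
  two terms can have any prescribed sum, so only the total weights of the distinct values matter,
  and these must be non-zero just for values occurring once. Three distinct values carry the
  weights \<open>y - z, z - x, x - y\<close> and four distinct values \<open>x, y, z, w\<close> carry
  \<open>z - w, w - z, y - x, x - y\<close>; these blocks settle every number of distinct values except 1, 2
  and 5, which are treated by hand. The only sequences of length \<open>n\<close> left without weights are
  those in which \<open>n - 1\<close> terms are equal to some \<open>y\<close> and the remaining one differs from \<open>y\<close> by a unit.
  Translated by \<open>-y\<close>, such a sequence has no \<open>Zn'\<close>-weighted zero sum either. Both constants
  equal \<open>n + 1\<close>, and the converse holds because \<open>(Zn', {1})\<close>-weighted zero sums are
  invariant under translation.
\<close>

section \<open>Weights on groups of equal terms\<close>

text \<open>Induction on \<open>F\<close>: one weight \<open>u\<close> is split off so that the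
  remaining total \<open>s - u\<close> is again not a multiple of \<open>m\<close>, which makes the
  induction hypothesis applicable even to a singleton.\<close>

lemma nonzero_weights_with_sum:
  fixes m s :: int
  assumes "m \<ge> 3" "finite F" "F \<noteq> {}" "card F \<ge> 2 \<or> \<not> m dvd s"
  shows "\<exists>a. (\<forall>i\<in>F. \<not> m dvd a i) \<and> sum a F = s"
  using assms(2-4)
proof (induction F arbitrary: s rule: finite_ne_induct)
  case (singleton i)
  then show ?case by (intro exI[of _ "\<lambda>_. s"]) auto
next
  case (insert i F)
  \<comment> \<open>The choice \<open>u = 1\<close> works unless \<open>s\<close> is congruent to 1;
    then \<open>u = -1\<close> leaves a total congruent to 2, non-zero because
    \<open>m \<ge> 3\<close>.\<close>
  obtain u where u: "\<not> m dvd u" "\<not> m dvd s - u"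
  proof (cases "m dvd s - 1")
    case True
    have "\<not> m dvd 2" "\<not> m dvd -1" using assms(1) zdvd_imp_le[of m 2] zdvd_imp_le[of m 1] by auto
    moreover have "s - (-1) = (s - 1) + 2" by simp
    ultimately show ?thesis using True that[of "-1"] dvd_add_right_iff[OF True] by metis
  next
    case False
    moreover have "\<not> m dvd 1" using assms(1) zdvd_imp_le[of m 1] by auto
    ultimately show ?thesis using that by blast
  qed
  obtain a where a: "\<forall>i\<in>F. \<not> m dvd a i" "sum a F = s - u"
    using insert.IH[of "s - u"] u by blast
  have "sum (a(i := u)) F = sum a F" using insert.hyps by (intro sum.cong) auto
  then show ?case using a u insert.hyps
    by (intro exI[of _ "a(i := u)"]) auto
qed

text \<open>Reduces the search for weights to the distinct values: \<open>c v\<close> is the total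
  weight of the terms equal to \<open>v\<close>, each such group is filled independently, and both
  sums regroup along the fibres of \<open>x\<close>.\<close>

lemma balanced_weights_of_values:
  fixes m :: int
  assumes "m \<ge> 3" "finite I"
    and c: "m dvd (\<Sum>v\<in>x ` I. c v)" "m dvd (\<Sum>v\<in>x ` I. c v * v)"
    and cls: "\<And>v. v \<in> x ` I \<Longrightarrow> card {i\<in>I. x i = v} \<ge> 2 \<or> \<not> m dvd c v"
  shows "\<exists>a. (\<forall>i\<in>I. \<not> m dvd a i) \<and> m dvd sum a I \<and> m dvd (\<Sum>i\<in>I. a i * x i)"
proof -
  have "\<forall>v\<in>x ` I. \<exists>a. (\<forall>i\<in>{i\<in>I. x i = v}. \<not> m dvd a i) \<and> sum a {i\<in>I. x i = v} = c v"
    using assms(1,2) cls by (intro ballI nonzero_weights_with_sum) auto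
  from bchoice[OF this] obtain A
    where "\<forall>v\<in>x ` I. (\<forall>i\<in>{i\<in>I. x i = v}. \<not> m dvd A v i) \<and> sum (A v) {i\<in>I. x i = v} = c v"
    by blast
  then have A: "\<forall>i\<in>{i\<in>I. x i = v}. \<not> m dvd A v i" "sum (A v) {i\<in>I. x i = v} = c v"
    if "v \<in> x ` I" for v using that by blast+
  define a where "a = (\<lambda>i. A (x i) i)"
  have s: "sum a {i\<in>I. x i = v} = c v" if "v \<in> x ` I" for v
    using A(2)[OF that] by (simp add: a_def)
  have "(\<Sum>i | i \<in> I \<and> x i = v. a i * x i) = c v * v" if "v \<in> x ` I" for v
    by (simp flip: s[OF that] sum_distrib_right)
  then have "(\<Sum>i\<in>I. a i * x i) = (\<Sum>v\<in>x ` I. c v * v)"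
    using sum.image_gen[OF assms(2), of "\<lambda>i. a i * x i" x] by simp
  moreover have "sum a I = (\<Sum>v\<in>x ` I. c v)"
    using sum.image_gen[OF assms(2), of a x] s by simp
  moreover have "\<forall>i\<in>I. \<not> m dvd a i" using A(1) by (auto simp: a_def)
  ultimately show ?thesis using c by metis
qed

section \<open>Explicit weights on sets of distinct values\<close>

text \<open>The sums vanish in the integers, not just modulo \<open>m\<close>, since the blocks
  below come from polynomial identities; only the non-vanishing of the weights refers to
  \<open>m\<close>.\<close>

definition balanced :: "int \<Rightarrow> int set \<Rightarrow> (int \<Rightarrow> int) \<Rightarrow> bool" where
  "balanced m V c \<longleftrightarrow> (\<forall>v\<in>V. \<not> m dvd c v) \<and> sum c V = 0 \<and> (\<Sum>v\<in>V. c v * v) = 0"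

lemma balanced_Un:
  assumes "balanced m V c" "balanced m W d" "finite V" "finite W" "V \<inter> W = {}"
  shows "\<exists>e. balanced m (V \<union> W) e"
proof -
  define e where "e = (\<lambda>v. if v \<in> V then c v else d v)"
  have "sum e V = sum c V" "(\<Sum>v\<in>V. e v * v) = (\<Sum>v\<in>V. c v * v)"
    by (auto simp: e_def intro!: sum.cong)
  moreover have "sum e W = sum d W" "(\<Sum>v\<in>W. e v * v) = (\<Sum>v\<in>W. d v * v)"
    using assms(5) by (auto simp: e_def intro!: sum.cong)
  moreover have "\<forall>v\<in>V \<union> W. \<not> m dvd e v"
    using assms(1,2) by (auto simp: balanced_def e_def)
  ultimately have "balanced m (V \<union> W) e"
    using assms by (simp add: balanced_def sum.union_disjoint)
  then show ?thesis by blast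
qed

lemma balanced_three:
  assumes "card V = 3" "\<And>v w. v \<in> V \<Longrightarrow> w \<in> V \<Longrightarrow> v \<noteq> w \<Longrightarrow> \<not> m dvd v - w"
  shows "\<exists>c. balanced m V c"
proof -
  obtain x y z where V: "V = {x, y, z}" and d: "x \<noteq> y" "x \<noteq> z" "y \<noteq> z"
    using assms(1) by (auto simp: card_3_iff)
  \<comment> \<open>These weights form the cross product of \<open>(x, y, z)\<close> and
    \<open>(1, 1, 1)\<close>, hence are orthogonal to both vectors.\<close>
  have "balanced m V ((\<lambda>_. 0)(x := y - z, y := z - x, z := x - y))"
    using d assms(2) by (auto simp: V balanced_def algebra_simps)
  then show ?thesis by blast
qed

lemma balanced_four:
  assumes "card V = 4" "\<And>v w. v \<in> V \<Longrightarrow> w \<in> V \<Longrightarrow> v \<noteq> w \<Longrightarrow> \<not> m dvd v - w"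
  shows "\<exists>c. balanced m V c"
proof -
  obtain x W where "V = insert x W" "x \<notin> W" "card W = 3"
    using assms(1) card_Suc_eq[of V 3] by auto
  then obtain y z w where V: "V = {x, y, z, w}"
    and d: "x \<noteq> y" "x \<noteq> z" "y \<noteq> z" "x \<noteq> w" "y \<noteq> w" "z \<noteq> w"
    by (auto simp: card_3_iff)
  \<comment> \<open>The pair \<open>x, y\<close> contributes \<open>(z - w) * (x - y)\<close>, and
    the pair \<open>z, w\<close> contributes its negative.\<close>
  have "balanced m V ((\<lambda>_. 0)(x := z - w, y := w - z, z := y - x, w := x - y))"
    using d assms(2) by (auto simp: V balanced_def algebra_simps)
  then show ?thesis by blast
qed

text \<open>Every integer from 3 on except 5 is a sum of 3s and 4s, so \<open>V\<close> splits into
  blocks of three and four values.\<close>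

lemma balanced_exists:
  assumes "finite V" "card V \<ge> 3" "card V \<noteq> 5"
    "\<And>v w. v \<in> V \<Longrightarrow> w \<in> V \<Longrightarrow> v \<noteq> w \<Longrightarrow> \<not> m dvd v - w"
  shows "\<exists>c. balanced m V c"
  using assms
proof (induction "card V" arbitrary: V rule: less_induct)
  case less
  note distinct = less.prems(4)
  \<comment> \<open>A block of 3 is removed, except from 8 values, where that would leave 5; there a
    block of 4 is removed.\<close>
  consider "card V = 3" | "card V = 4" | k where "k \<in> {3, 4}" "card V \<ge> k + 3" "card V \<noteq> k + 5"
    using less.prems(2,3) by (cases "card V = 8"; force)
  then show ?case
  proof cases
    case (3 k)
    obtain W where W: "W \<subseteq> V" "card W = k"
      using 3 obtain_subset_with_card_n[of k V] by auto
    have fin: "finite W" using W less.prems(1) finite_subset by blast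
    have "\<exists>c. balanced m W c"
      using 3(1) W distinct balanced_three[of W m] balanced_four[of W m] by blast
    moreover have "card (V - W) = card V - k" using W fin by (simp add: card_Diff_subset)
    then have "\<exists>c. balanced m (V - W) c"
      using 3 less.prems(1) distinct by (intro less.hyps) auto
    ultimately show ?thesis
      using balanced_Un[of m W _ "V - W"] fin less.prems(1) W(1)
      by (metis Diff_disjoint Diff_partition finite_Diff)
  qed (use balanced_three balanced_four distinct in blast)+
qed

section \<open>Sequences of length \<open>n\<close>\<close>

text \<open>The multiset leaves the position of \<open>z\<close> open. Coprimality says that
  \<open>z - y\<close> is a unit modulo \<open>n\<close>; for \<open>n \<ge> 2\<close> it forces
  \<open>z \<noteq> y\<close>.\<close>

definition exceptional :: "nat \<Rightarrow> int multiset \<Rightarrow> bool" where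
  "exceptional n M \<longleftrightarrow>
     (\<exists>y z. M = add_mset z (replicate_mset (n - 1) y) \<and> coprime (z - y) (int n))"

lemma balanced_weights_or_exceptional:
  fixes n :: nat
  assumes n: "n \<ge> 2" "n \<noteq> 3" and T: "length T = n" "set T \<subseteq> {0..<int n}"
  shows "(\<exists>a. (\<forall>i<n. \<not> int n dvd a i) \<and> int n dvd (\<Sum>i<n. a i) \<and>
            int n dvd (\<Sum>i<n. a i * T ! i)) \<or> exceptional n (mset T)"
proof -
  \<comment> \<open>The multiplicity of \<open>v\<close>, written with indices to match the groups
    in \<open>balanced_weights_of_values\<close>.\<close>
  define cl where "cl = (\<lambda>v. card {i. i < n \<and> T ! i = v})"
  have count: "count (mset T) v = cl v" for v
    using T(1) by (simp add: cl_def count_mset count_list_eq_length_filter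
        length_filter_conv_card eq_commute)
  have V: "set T = (!) T ` {..<n}" using T(1) by (auto simp: set_conv_nth)
  have cl_pos: "cl v \<ge> 1" if "v \<in> set T" for v
    using that count[of v] by (metis One_nat_def Suc_leI count_greater_zero_iff set_mset_mset)
  have cl_sum: "(\<Sum>v\<in>set T. cl v) = n"
    using T(1) size_multiset_overloaded_eq[of "mset T"] count by simp
  have neq: "\<not> int n dvd v - w" if "v \<in> set T" "w \<in> set T" "v \<noteq> w" for v w
  proof -
    have "v \<in> {0..<int n}" "w \<in> {0..<int n}" using that T(2) by auto
    then have "\<bar>v - w\<bar> < int n" by auto
    then show ?thesis using that(3) dvd_imp_le_int[of "v - w" "int n"] by auto
  qed
  have lift: ?thesis
    if "n \<ge> 3" "int n dvd sum c (set T)" "int n dvd (\<Sum>v\<in>set T. c v * v)"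
      "\<And>v. v \<in> set T \<Longrightarrow> cl v \<ge> 2 \<or> \<not> int n dvd c v" for c
    using balanced_weights_of_values[of "int n" "{..<n}" c "(!) T"] that
    unfolding V cl_def by auto
  have lift_balanced: ?thesis if "balanced (int n) (set T) c" "n \<ge> 3" for c
    using that lift[of c] by (auto simp: balanced_def)
  have nd1: "\<not> int n dvd 1" using n(1) by auto
  have card_le: "card (set T) \<le> n" using T(1) card_length by blast
  have "card (set T) \<ge> 1" using T(1) n(1) by (cases T) (auto simp: Suc_le_eq card_gt_0_iff)
  then consider "card (set T) = 1" | "card (set T) = 2" | "card (set T) = 5"
    | "card (set T) \<ge> 3" "card (set T) \<noteq> 5" by linarith
  then show ?thesis
  proof cases
    case 1
    then obtain y where "set T = {y}" by (auto simp: card_1_singleton_iff)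
    then have "\<forall>i<n. T ! i = y" using T(1) by (metis nth_mem singletonD)
    then show ?thesis using nd1 by (intro disjI1 exI[of _ "\<lambda>_. 1"]) auto
  next
    case 2
    then obtain y z where yz: "set T = {y, z}" "y \<noteq> z" by (auto simp: card_2_iff)
    have csum: "cl y + cl z = n" using cl_sum yz by simp
    have exc: "exceptional n (mset T)"
      if st: "cl t = 1" "cl s = n - 1" "{s, t} = set T" "s \<noteq> t" "coprime (t - s) (int n)" for s t
    proof -
      have "mset T = add_mset t (replicate_mset (n - 1) s)"
      proof (rule multiset_eqI)
        fix v
        have "count (mset T) v = 0" if "v \<notin> {s, t}"
          using that st(3) by (simp add: count_eq_zero_iff)
        then show "count (mset T) v = count (add_mset t (replicate_mset (n - 1) s)) v"
          using st(1,2,4) by (cases "v = s"; cases "v = t") (auto simp: count)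
      qed
      then show ?thesis using st(5) unfolding exceptional_def by blast
    qed
    show ?thesis
    proof (cases "coprime (y - z) (int n)")
      case True
      moreover have "coprime (z - y) (int n)"
        using True by (subst minus_diff_eq[symmetric], subst coprime_minus_left_iff)
      moreover have "cl y = 1 \<or> cl z = 1 \<or> (cl y \<ge> 2 \<and> cl z \<ge> 2)"
        using cl_pos[of y] cl_pos[of z] yz(1) by auto
      \<comment> \<open>A unit difference forces both group totals to be 0 modulo \<open>n\<close>.
        This is possible when both values repeat; otherwise one of them occurs once and the sequence
        is exceptional.\<close>
      moreover have ?thesis if "cl y \<ge> 2" "cl z \<ge> 2"
        using that yz(1) csum by (intro lift[of "\<lambda>_. 0"]) auto
      moreover have "{z, y} = set T" using yz(1) by auto
      ultimately show ?thesis
        using exc[of y z] exc[of z y] csum yz by (metis add_diff_cancel_left' add_diff_cancel_right')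
    next
      case False
      \<comment> \<open>The cofactor \<open>k\<close> of \<open>g\<close> in \<open>n\<close> is
        non-zero modulo \<open>n\<close> but annihilates \<open>y - z\<close>, so the totals
        \<open>k\<close> and \<open>-k\<close> work even for values occurring once.\<close>
      define g where "g = gcd (y - z) (int n)"
      have g: "g dvd y - z" "g dvd int n" "g > 0" "g \<noteq> 1"
        using False n(1) by (auto simp: g_def coprime_iff_gcd_eq_1)
      obtain k where k: "int n = g * k" using g(2) by (rule dvdE)
      obtain l where l: "y - z = g * l" using g(1) by (rule dvdE)
      have "g * k > 0" using k n(1) by linarith
      then have "k > 0" using g(3) by (simp add: zero_less_mult_iff)
      moreover have "k * 1 < k * g" using \<open>k > 0\<close> g by (intro mult_strict_left_mono) auto
      then have "k < int n" using k by (simp add: mult.commute)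
      ultimately have nk: "\<not> int n dvd k" using zdvd_imp_le[of "int n" k] by linarith
      \<comment> \<open>For \<open>n = 2\<close>, two distinct values differ by 1 or -1, which is a
        unit.\<close>
      have "n \<ge> 3"
      proof (rule ccontr)
        assume "\<not> n \<ge> 3"
        then have "{y, z} \<subseteq> {0, 1}" using T(2) yz n by fastforce
        then have "y - z = 1 \<or> y - z = -1" using yz(2) by auto
        then show False using False by auto
      qed
      have "k * y - k * z = k * (y - z)" by (simp add: algebra_simps)
      also have "\<dots> = int n * l" using k l by simp
      finally have "k * y - k * z = int n * l" .
      then have "int n dvd k * y - k * z" by simp
      then show ?thesis using nk yz \<open>n \<ge> 3\<close>
        by (intro lift[of "(\<lambda>_. -k)(y := k)"]) auto
    qed
  next
    case 3
    show ?thesis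
    proof (cases "n = 5")
      case True
      \<comment> \<open>All residues modulo 5 occur once, and their sum is 10, so all weights may be
        1.\<close>
      have "set T = {0..<5}" using T(2) 3 True by (intro card_subset_eq) auto
      moreover have "{0..<5::int} = {0, 1, 2, 3, 4}" by auto
      ultimately show ?thesis using True by (intro lift[of "\<lambda>_. 1"]) auto
    next
      case False
      \<comment> \<open>Now \<open>n > 5\<close>, so some value repeats. It can take total weight 0,
        and the other four values form a balanced block.\<close>
      have "\<exists>v\<in>set T. cl v \<ge> 2"
      proof (rule ccontr)
        assume "\<not> ?thesis"
        then have "(\<Sum>v\<in>set T. cl v) \<le> (\<Sum>v\<in>set T. 1)" by (intro sum_mono) force
        then show False using cl_sum 3 False card_le by simp
      qed
      then obtain v where v: "v \<in> set T" "cl v \<ge> 2" by blast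
      have "\<exists>c. balanced (int n) (set T - {v}) c"
        using 3 v neq by (intro balanced_exists) auto
      then obtain c where c: "balanced (int n) (set T - {v}) c" by blast
      define d where "d = c(v := 0)"
      have "sum d (set T) = sum d (set T - {v})"
        "(\<Sum>w\<in>set T. d w * w) = (\<Sum>w\<in>set T - {v}. d w * w)"
        using v(1) by (simp_all add: sum.remove[of "set T" v] d_def)
      moreover have "sum d (set T - {v}) = sum c (set T - {v})"
        "(\<Sum>w\<in>set T - {v}. d w * w) = (\<Sum>w\<in>set T - {v}. c w * w)"
        by (auto simp: d_def intro!: sum.cong)
      ultimately show ?thesis using c v 3 card_le
        by (intro lift[of d]) (auto simp: balanced_def d_def)
    qed
  next
    case 4
    then show ?thesis using balanced_exists[of "set T" "int n"] neq lift_balanced card_le by fastforce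
  qed
qed

section \<open>Weighted zero sums and translation\<close>

lemma weighted_zero_sum2_one_iff:
  "weighted_zero_sum2 n A {1} T \<longleftrightarrow>
     (\<exists>as. length as = length T \<and> set as \<subseteq> A \<and>
        [(\<Sum>i<length T. as ! i * T ! i) = 0] (mod int n) \<and>
        [(\<Sum>i<length T. as ! i) = 0] (mod int n))" (is "_ \<longleftrightarrow> (\<exists>as. ?P as)")
proof
  assume "weighted_zero_sum2 n A {1} T"
  then obtain as bs where *: "length as = length T" "set as \<subseteq> A" "length bs = length T" "set bs \<subseteq> {1}"
    "[(\<Sum>i<length T. as ! i * T ! i) = 0] (mod int n)"
    "[(\<Sum>i<length T. bs ! i * as ! i) = 0] (mod int n)"
    by (auto simp: weighted_zero_sum2_def)
  have "(\<Sum>i<length T. bs ! i * as ! i) = (\<Sum>i<length T. as ! i)"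
    using *(3,4) by (intro sum.cong refl) (metis lessThan_iff mult_1 nth_mem singletonD subsetD)
  then show "\<exists>as. ?P as" using * by auto
next
  assume "\<exists>as. ?P as"
  then obtain as where "?P as" by blast
  then show "weighted_zero_sum2 n A {1} T"
    unfolding weighted_zero_sum2_def
    by (intro exI[of _ as] exI[of _ "replicate (length T) 1"]) auto
qed

lemma weighted_zero_sum2_imp: "weighted_zero_sum2 n A B T \<Longrightarrow> weighted_zero_sum n A T"
  unfolding weighted_zero_sum_def weighted_zero_sum2_def by blast

text \<open>A shift by \<open>x\<close> changes the weighted sum by \<open>x\<close> times the total
  weight, which is 0 modulo \<open>n\<close>.\<close>

lemma weighted_zero_sum2_translate:
  assumes "weighted_zero_sum2 n A {1} (map (\<lambda>y. (y + x) mod int n) T)"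
  shows "weighted_zero_sum2 n A {1} T"
proof -
  obtain as where as: "length as = length T" "set as \<subseteq> A"
    "[(\<Sum>i<length T. as ! i * ((T ! i + x) mod int n)) = 0] (mod int n)"
    "[(\<Sum>i<length T. as ! i) = 0] (mod int n)"
    using assms by (auto simp: weighted_zero_sum2_one_iff)
  have "[(\<Sum>i<length T. as ! i * ((T ! i + x) mod int n))
       = (\<Sum>i<length T. as ! i * (T ! i + x))] (mod int n)"
    by (intro cong_sum cong_mult cong_refl) (simp add: cong_def)
  then have "int n dvd (\<Sum>i<length T. as ! i * (T ! i + x))"
    using as(3) by (simp add: cong_0_iff cong_dvd_iff)
  moreover have "(\<Sum>i<length T. as ! i * (T ! i + x))
      = (\<Sum>i<length T. as ! i * T ! i) + (\<Sum>i<length T. as ! i) * x"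
    by (simp add: algebra_simps sum.distrib sum_distrib_left)
  moreover have "int n dvd (\<Sum>i<length T. as ! i) * x" using as(4) by (simp add: cong_0_iff)
  ultimately have "int n dvd (\<Sum>i<length T. as ! i * T ! i)" by (simp add: dvd_add_left_iff)
  then show ?thesis using as by (auto simp: weighted_zero_sum2_one_iff cong_0_iff)
qed

lemma weighted_zero_sum2_or_exceptional:
  assumes n: "n \<ge> 2" "n \<noteq> 3" and T: "length T = n" "seq_in n T"
  shows "weighted_zero_sum2 n (Zn' n) {1} T \<or> exceptional n (mset T)"
proof (rule disjCI)
  assume "\<not> exceptional n (mset T)"
  moreover have "set T \<subseteq> {0..<int n}" using T by (simp add: seq_in_def Zn_def)
  ultimately obtain a where a: "\<forall>i<n. \<not> int n dvd a i" "int n dvd (\<Sum>i<n. a i)"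
    "int n dvd (\<Sum>i<n. a i * T ! i)"
    using balanced_weights_or_exceptional[OF n T(1)] by blast
  \<comment> \<open>Reduction modulo \<open>n\<close> moves the weights into \<open>Zn' n\<close>;
    they stay non-zero because no \<open>a i\<close> is a multiple of \<open>n\<close>.\<close>
  define as where "as = map (\<lambda>i. a i mod int n) [0..<n]"
  have "[(\<Sum>i<n. as ! i) = (\<Sum>i<n. a i)] (mod int n)"
    by (intro cong_sum) (simp add: as_def cong_def)
  moreover have "[(\<Sum>i<n. as ! i * T ! i) = (\<Sum>i<n. a i * T ! i)] (mod int n)"
    by (intro cong_sum cong_mult cong_refl) (simp add: as_def cong_def)
  moreover have "set as \<subseteq> Zn' n"
    using a(1) n(1) by (auto simp: as_def Zn'_def Zn_def mod_eq_0_iff_dvd)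
  ultimately show "weighted_zero_sum2 n (Zn' n) {1} T"
    using a(2,3) T(1) unfolding weighted_zero_sum2_one_iff
    by (intro exI[of _ as]) (auto simp: as_def cong_0_iff cong_dvd_iff)
qed

text \<open>Only the term \<open>u\<close> contributes, and a unit times a non-zero weight is
  non-zero.\<close>

lemma no_weighted_zero_sum_single_unit:
  assumes "mset T = add_mset u (replicate_mset k 0)" "coprime u (int n)"
  shows "\<not> weighted_zero_sum n (Zn' n) T"
proof
  assume "weighted_zero_sum n (Zn' n) T"
  then obtain as where as: "length as = length T" "set as \<subseteq> Zn' n"
    "int n dvd (\<Sum>i<length T. as ! i * T ! i)"
    by (auto simp: weighted_zero_sum_def cong_0_iff)
  have "u \<in> set T" using assms(1) by (metis set_mset_mset union_single_eq_member)
  then obtain xs ys where T: "T = xs @ u # ys" by (meson split_list)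
  then have "mset xs + mset ys = replicate_mset k 0" using assms(1) by simp
  then have "set xs \<union> set ys \<subseteq> {0}"
    by (metis set_mset_mset set_mset_union set_mset_replicate_mset_subset
        subsetI empty_iff)
  then have "T ! i = 0" if "i < length T" "i \<noteq> length xs" for i
    using that T by (auto simp: nth_append nth_Cons' subset_iff)
  then have "(\<Sum>i<length T. as ! i * T ! i)
      = (\<Sum>i\<in>{length xs}. as ! i * T ! i)"
    using T by (intro sum.mono_neutral_right) auto
  then have "int n dvd as ! length xs * u" using as(3) T by simp
  then have "int n dvd as ! length xs"
    using assms(2) by (simp add: coprime_dvd_mult_left_iff coprime_commute)
  moreover have "as ! length xs \<in> Zn' n" using as(1,2) T by (auto simp: subset_iff)
  ultimately show False using zdvd_imp_le[of "int n" "as ! length xs"] by (auto simp: Zn'_def Zn_def)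
qed

section \<open>The values of the two constants\<close>

lemma has_wzs_subseq_length_eq:
  assumes "length S = n" "n > 0"
  shows "has_wzs_subseq n A S \<longleftrightarrow> weighted_zero_sum n A S"
    and "has_wzs2_subseq n A B S \<longleftrightarrow> weighted_zero_sum2 n A B S"
proof -
  have "subsequence T S \<and> length T = n \<longleftrightarrow> T = S" for T
    using assms subseq_same_length[of T S] by (auto simp: subsequence_def)
  then show "has_wzs_subseq n A S \<longleftrightarrow> weighted_zero_sum n A S"
    "has_wzs2_subseq n A B S \<longleftrightarrow> weighted_zero_sum2 n A B S"
    unfolding has_wzs_subseq_def has_wzs2_subseq_def by metis+
qed

lemma has_wzs2_imp_has_wzs: "has_wzs2_subseq n A B S \<Longrightarrow> has_wzs_subseq n A S"
  unfolding has_wzs_subseq_def has_wzs2_subseq_def using weighted_zero_sum2_imp by blast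

text \<open>Otherwise deleting any term would leave an exceptional sequence; deleting two different
  values in turn gives incompatible shapes.\<close>

lemma has_wzs2_subseq_Suc:
  assumes n: "n \<ge> 2" "n \<noteq> 3" and S: "length S = Suc n" "seq_in n S"
  shows "has_wzs2_subseq n (Zn' n) {1} S"
proof (rule ccontr)
  assume no: "\<not> ?thesis"
  have exc: "exceptional n (mset S - {#v#})" if "v \<in> set S" for v
  proof -
    have T: "length (remove1 v S) = n" "seq_in n (remove1 v S)"
      using that S by (auto simp: length_remove1 seq_in_def dest: notin_set_remove1)
    have "subseq (remove1 v S) S" by (induction S) auto
    then have "subsequence (remove1 v S) S" using T n by (auto simp: subsequence_def)
    then have "\<not> weighted_zero_sum2 n (Zn' n) {1} (remove1 v S)"
      using no T(1) unfolding has_wzs2_subseq_def by blast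
    then show ?thesis using weighted_zero_sum2_or_exceptional[OF n T] by simp
  qed
  have unit: "z \<noteq> y" if "coprime (z - y) (int n)" for y z using that n by auto
  obtain v where v: "v \<in> set S" using S by (cases S) auto
  obtain y z where yz: "mset S - {#v#} = add_mset z (replicate_mset (n - 1) y)" "z \<noteq> y"
    using exc[OF v] unit unfolding exceptional_def by blast
  then have M: "mset S = {#v, z#} + replicate_mset (n - 1) y"
    using v by (metis insert_DiffM set_mset_mset union_mset_add_mset_left
        empty_neutral(1))
  have mem: "y \<in># mset S" "z \<in># mset S" using n unfolding M by auto
  \<comment> \<open>A value of the sequence other than \<open>v\<close>, to be deleted instead of
    \<open>v\<close>.\<close>
  define w where "w = (if v = y then z else y)"
  have "w \<in> set S" using mem by (simp add: w_def)
  then obtain y' z' where y'z': "mset S - {#w#} = add_mset z' (replicate_mset (n - 1) y')" "z' \<noteq> y'"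
    using exc[of w] unit unfolding exceptional_def by blast
  have cnt: "count (mset S - {#w#}) y' = n - 1" "count (mset S - {#w#}) z' = 1"
    using y'z' by auto
  show False
  proof (cases "v = y")
    case True
    \<comment> \<open>Only copies of \<open>y\<close> remain, but an exceptional sequence has two
      distinct values.\<close>
    then have "mset S - {#w#} = replicate_mset (Suc (n - 1)) y" unfolding M w_def by simp
    then show False using cnt y'z'(2) n by (auto split: if_splits)
  next
    case False
    obtain k where k: "n = Suc (Suc k)" using n(1) by (metis add_2_eq_Suc le_Suc_ex)
    have rest: "mset S - {#w#} = {#v, z#} + replicate_mset k y"
      using False unfolding M w_def k by simp
    \<comment> \<open>The value \<open>y\<close> is left \<open>k\<close> times, one short of the
      required \<open>n - 1\<close>.\<close>
    have "y' \<noteq> y" using cnt(1) False yz(2) unfolding rest k by auto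
    \<comment> \<open>Apart from \<open>y\<close> only \<open>v\<close> and \<open>z\<close> remain,
      so \<open>n - 1\<close> is at most 2. As \<open>n \<noteq> 3\<close>, this gives
      \<open>n = 2\<close>, where three distinct residues cannot exist.\<close>
    then have "k = 0" "v \<noteq> z"
      using cnt(1) n unfolding rest k by (auto split: if_splits)
    moreover have "{y, z, v} \<subseteq> {0..<int n}" using mem v S(2) by (auto simp: seq_in_def Zn_def)
    ultimately show False using False yz(2) k by auto
  qed
qed

text \<open>The stronger notion implies the weaker one, so a lower bound for \<open>Zn'\<close>
  alone and an upper bound for \<open>(Zn', {1})\<close> settle both constants.\<close>

lemma E_const_eq:
  assumes "n \<ge> 2" "n \<noteq> 3"
  shows "E_const n (Zn' n) = Suc n" and "E_const2 n (Zn' n) {1} = Suc n"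
proof -
  have low: "\<exists>S. seq_in n S \<and> length S = k \<and> \<not> has_wzs_subseq n (Zn' n) S" if "k \<le> n" for k
  proof (cases "k = n")
    case True
    \<comment> \<open>A single unit among zeros has no \<open>Zn'\<close>-weighted zero sum.\<close>
    define S where "S = 1 # replicate (n - 1) (0::int)"
    have "length S = n" "seq_in n S" using assms by (auto simp: S_def seq_in_def Zn_def)
    moreover have "\<not> weighted_zero_sum n (Zn' n) S"
      by (rule no_weighted_zero_sum_single_unit[of _ 1 "n - 1"]) (auto simp: S_def)
    ultimately show ?thesis using assms True has_wzs_subseq_length_eq(1)[of S n] by auto
  next
    case False
    \<comment> \<open>A sequence shorter than \<open>n\<close> has no subsequence of length
      \<open>n\<close>.\<close>
    then have "\<not> has_wzs_subseq n (Zn' n) (replicate k 0)" using that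
      by (auto simp: has_wzs_subseq_def subsequence_def dest!: list_emb_length)
    moreover have "seq_in n (replicate k 0)" using assms by (auto simp: seq_in_def Zn_def)
    ultimately show ?thesis by (intro exI[of _ "replicate k 0"]) auto
  qed
  have up: "has_wzs2_subseq n (Zn' n) {1} S" if "seq_in n S \<and> length S = Suc n" for S
    using that has_wzs2_subseq_Suc assms by blast
  show "E_const n (Zn' n) = Suc n" unfolding E_const_def
    using low up has_wzs2_imp_has_wzs
    by (intro Least_equality) (blast, metis not_less_eq_eq)
  show "E_const2 n (Zn' n) {1} = Suc n" unfolding E_const2_def
    using low up has_wzs2_imp_has_wzs
    by (intro Least_equality) (blast, metis not_less_eq_eq)
qed

theorem theorem11:
  fixes n :: nat and S :: "int list"
  assumes "n \<ge> 2" and "n \<noteq> 3" and "seq_in n S"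
  shows "E_extremal2 n (Zn' n) {1} S \<longleftrightarrow>
         (\<exists>T. E_extremal n (Zn' n) T \<and> is_translate n S T)"
proof
  assume "E_extremal2 n (Zn' n) {1} S"
  \<comment> \<open>As the constants equal \<open>n + 1\<close>, extremal sequences have length
    \<open>n\<close>, and the whole sequence is the only subsequence to test.\<close>
  then have S: "length S = n" and "\<not> has_wzs2_subseq n (Zn' n) {1} S"
    using assms by (auto simp: E_extremal2_def E_const_eq)
  then have "\<not> weighted_zero_sum2 n (Zn' n) {1} S"
    using assms(1) has_wzs_subseq_length_eq(2)[of S n] by simp
  with S obtain y z where yz: "mset S = add_mset z (replicate_mset (n - 1) y)"
    "coprime (z - y) (int n)"
    using weighted_zero_sum2_or_exceptional[of n S] assms unfolding exceptional_def by blast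
  have "y \<in># mset S" using assms(1) yz by auto
  then have y: "y \<in> Zn n" using assms(3) by (auto simp: seq_in_def)
  \<comment> \<open>Translation by \<open>-y\<close> turns the \<open>n - 1\<close> equal terms into
    0 and the remaining one into the unit \<open>z - y\<close>.\<close>
  define T where "T = map (\<lambda>s. (s - y) mod int n) S"
  have "mset T = add_mset ((z - y) mod int n) (replicate_mset (n - 1) 0)"
    unfolding T_def mset_map yz(1) by simp
  then have "\<not> weighted_zero_sum n (Zn' n) T"
    using yz(2) assms(1) no_weighted_zero_sum_single_unit[of T "(z - y) mod int n"] by simp
  moreover have T: "length T = n" "seq_in n T"
    using S assms(1) by (simp_all add: T_def seq_in_def Zn_def image_subset_iff)
  ultimately have "E_extremal n (Zn' n) T"
    using assms(1,2) has_wzs_subseq_length_eq(1)[OF T(1)]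
    by (simp add: E_extremal_def E_const_eq)
  moreover have "S = map (\<lambda>t. (t + y) mod int n) T"
    using assms(3) unfolding T_def map_map
    by (intro map_idI[symmetric]) (auto simp: mod_add_left_eq seq_in_def Zn_def subset_iff)
  ultimately show "\<exists>T. E_extremal n (Zn' n) T \<and> is_translate n S T"
    using y unfolding is_translate_def by blast
next
  assume "\<exists>T. E_extremal n (Zn' n) T \<and> is_translate n S T"
  then obtain T x where T: "E_extremal n (Zn' n) T" "S = map (\<lambda>y. (y + x) mod int n) T"
    by (auto simp: is_translate_def)
  then have len: "length T = n" and "\<not> has_wzs_subseq n (Zn' n) T"
    using assms(1,2) by (auto simp: E_extremal_def E_const_eq)
  then have "\<not> weighted_zero_sum n (Zn' n) T"
    using assms(1) has_wzs_subseq_length_eq(1)[OF len] by simp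
  \<comment> \<open>A zero sum of \<open>S\<close> would pass to \<open>T\<close> with the same
    weights, since these sum to 0.\<close>
  then have "\<not> weighted_zero_sum2 n (Zn' n) {1} S"
    using T(2) weighted_zero_sum2_translate weighted_zero_sum2_imp by blast
  moreover have "length S = n" using len T(2) by simp
  ultimately show "E_extremal2 n (Zn' n) {1} S"
    using assms has_wzs_subseq_length_eq(2)[of S n] by (simp add: E_extremal2_def E_const_eq)
qed

end
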